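(* Let $\psi:T\to\mathbb{C}$ and let $X$ be either $\mathcal{L}_{\mathbf{w}}$ or $\mathcal{L}_{\mathbf{w},0}$. Suppose $M_\psi:X\to L^\infty$ is a bounded multiplication operator. Then its essential norm is $$\|M_\psi\|_e=\lim_{n\to\infty}\sup_{|v|\ge n}(\log|v|)\,|\psi(v)|.$$
   Context: $T$ is the vertex set of a tree (a locally finite, connected, simply connected graph), rooted at a vertex $o$ and without terminal vertices (a terminal vertex is one having a unique neighbor), hence infinite. $|v|$ is the number of edges in the path from $o$ to $v$; $T^*=T\setminus\{o\}$; for $v\in T^*$, $v^-$ is the neighbor of $v$ closest to $o$. For $f:T\to\mathbb{C}$ and $v\in T^*$, $Df(v)=|f(v)-f(v^-)|$. The weighted Lipschitz space $\mathcal{L}_{\mathbf{w}}$ is the Banach space of all $f:T\to\mathbb{C}$ with $\sup_{v\in T^*}|v|Df(v)<\infty$, with norm $\|f\|_{\mathbf{w}}=|f(o)|+\sup_{v\in T^*}|v|Df(v)$; the little weighted Lipschitz space is the closed subspace $\mathcal{L}_{\mathbf{w},0}=\{f\in\mathcal{L}_{\mathbf{w}}:\lim_{|v|\to\infty}|v|Df(v)=0\}$. $L^\infty$ is the Banach space of bounded functions $f:T\to\mathbb{C}$ with $\|f\|_\infty=\sup_{v\in T}|f(v)|$. For $\psi:T\to\mathbb{C}$, $M_\psi f=\psi f$ (pointwise product). "$M_\psi:X\to Y$ is bounded" means that $\psi f\in Y$ for all $f\in X$ and $M_\psi$ is a bounded linear operator. The essential norm of a bounded operator $S:X\to Y$ between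 Banach spaces is $\|S\|_e=\inf\{\|S-K\|:K\text{ is a compact operator from }X\text{ to }Y\}$. *)

theory Defs
  imports "HOL-Analysis.Analysis"
begin

section \<open>Rooted trees\<close>

text \<open>A graph on the vertex type \<open>'a\<close> is given by its adjacency relation; the vertex set of the
  tree is the whole type. Paths are lists of pairwise distinct vertices, so a path with \<open>n\<close> edges
  has length \<open>Suc n\<close>.\<close>

definition path_between :: "('a \<Rightarrow> 'a \<Rightarrow> bool) \<Rightarrow> 'a \<Rightarrow> 'a \<Rightarrow> 'a list \<Rightarrow> bool" where
  "path_between E u v p \<longleftrightarrow>
     p \<noteq> [] \<and> hd p = u \<and> last p = v \<and> distinct p \<and> successively E p"

definition graph_cycle :: "('a \<Rightarrow> 'a \<Rightarrow> bool) \<Rightarrow> 'a list \<Rightarrow> bool" where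
  "graph_cycle E p \<longleftrightarrow>
     3 \<le> length p \<and> distinct p \<and> successively E p \<and> E (last p) (hd p)"

definition is_tree :: "('a \<Rightarrow> 'a \<Rightarrow> bool) \<Rightarrow> bool" where
  "is_tree E \<longleftrightarrow>
     symp E \<and> irreflp E \<and>
     (\<forall>v. finite {u. E v u}) \<and>
     (\<forall>u v. \<exists>p. path_between E u v p) \<and>
     (\<nexists>p. graph_cycle E p)"

definition terminal_vertex :: "('a \<Rightarrow> 'a \<Rightarrow> bool) \<Rightarrow> 'a \<Rightarrow> bool" where
  "terminal_vertex E v \<longleftrightarrow> (\<exists>!u. E v u)"

definition depth :: "('a \<Rightarrow> 'a \<Rightarrow> bool) \<Rightarrow> 'a \<Rightarrow> 'a \<Rightarrow> nat" where
  "depth E r v = (THE n. \<exists>p. path_between E r v p \<and> length p = Suc n)"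

definition parent :: "('a \<Rightarrow> 'a \<Rightarrow> bool) \<Rightarrow> 'a \<Rightarrow> 'a \<Rightarrow> 'a" where
  "parent E r v = (ARG_MIN (depth E r) u. E v u)"


section \<open>Operators between normed spaces of functions\<close>

text \<open>A normed space of complex functions is given by its carrier \<open>X\<close> and its norm \<open>nX\<close>, and an
  operator is a HOL function of which only the values on the carrier matter.\<close>

definition bounded_operator ::
  "('a \<Rightarrow> complex) set \<Rightarrow> (('a \<Rightarrow> complex) \<Rightarrow> real) \<Rightarrow>
   ('b \<Rightarrow> complex) set \<Rightarrow> (('b \<Rightarrow> complex) \<Rightarrow> real) \<Rightarrow>
   (('a \<Rightarrow> complex) \<Rightarrow> 'b \<Rightarrow> complex) \<Rightarrow> bool" where
  "bounded_operator X nX Y nY S \<longleftrightarrow>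
     (\<forall>f\<in>X. S f \<in> Y) \<and>
     (\<forall>f\<in>X. \<forall>g\<in>X. S (\<lambda>v. f v + g v) = (\<lambda>w. S f w + S g w)) \<and>
     (\<forall>c. \<forall>f\<in>X. S (\<lambda>v. c * f v) = (\<lambda>w. c * S f w)) \<and>
     (\<exists>C. \<forall>f\<in>X. nY (S f) \<le> C * nX f)"

definition operator_norm ::
  "('a \<Rightarrow> complex) set \<Rightarrow> (('a \<Rightarrow> complex) \<Rightarrow> real) \<Rightarrow> (('b \<Rightarrow> complex) \<Rightarrow> real) \<Rightarrow>
   (('a \<Rightarrow> complex) \<Rightarrow> 'b \<Rightarrow> complex) \<Rightarrow> real" where
  "operator_norm X nX nY S = (SUP f\<in>{f\<in>X. nX f \<le> 1}. nY (S f))"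

text \<open>\<^const>\<open>Metric_space\<close> requires nonnegativity and symmetry also off the carrier, where a
  norm defined by a supremum has no meaningful value; hence the case distinction.\<close>

definition norm_dist ::
  "('a \<Rightarrow> complex) set \<Rightarrow> (('a \<Rightarrow> complex) \<Rightarrow> real) \<Rightarrow>
   ('a \<Rightarrow> complex) \<Rightarrow> ('a \<Rightarrow> complex) \<Rightarrow> real" where
  "norm_dist Y nY f g = (if f \<in> Y \<and> g \<in> Y then nY (\<lambda>v. f v - g v) else 0)"

definition norm_topology ::
  "('a \<Rightarrow> complex) set \<Rightarrow> (('a \<Rightarrow> complex) \<Rightarrow> real) \<Rightarrow> ('a \<Rightarrow> complex) topology" where
  "norm_topology Y nY = Metric_space.mtopology Y (norm_dist Y nY)"

definition compact_operator ::
  "('a \<Rightarrow> complex) set \<Rightarrow> (('a \<Rightarrow> complex) \<Rightarrow> real) \<Rightarrow>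
   ('b \<Rightarrow> complex) set \<Rightarrow> (('b \<Rightarrow> complex) \<Rightarrow> real) \<Rightarrow>
   (('a \<Rightarrow> complex) \<Rightarrow> 'b \<Rightarrow> complex) \<Rightarrow> bool" where
  "compact_operator X nX Y nY K \<longleftrightarrow>
     bounded_operator X nX Y nY K \<and>
     compactin (norm_topology Y nY)
       (norm_topology Y nY closure_of (K ` {f\<in>X. nX f \<le> 1}))"

definition essential_norm ::
  "('a \<Rightarrow> complex) set \<Rightarrow> (('a \<Rightarrow> complex) \<Rightarrow> real) \<Rightarrow>
   ('b \<Rightarrow> complex) set \<Rightarrow> (('b \<Rightarrow> complex) \<Rightarrow> real) \<Rightarrow>
   (('a \<Rightarrow> complex) \<Rightarrow> 'b \<Rightarrow> complex) \<Rightarrow> real" where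
  "essential_norm X nX Y nY S =
     (INF K\<in>{K. compact_operator X nX Y nY K}. operator_norm X nX nY (\<lambda>f w. S f w - K f w))"


section \<open>Function spaces on a rooted tree\<close>

definition tree_deriv ::
  "('a \<Rightarrow> 'a \<Rightarrow> bool) \<Rightarrow> 'a \<Rightarrow> ('a \<Rightarrow> complex) \<Rightarrow> 'a \<Rightarrow> real" where
  "tree_deriv E r f v = cmod (f v - f (parent E r v))"

definition weighted_lipschitz :: "('a \<Rightarrow> 'a \<Rightarrow> bool) \<Rightarrow> 'a \<Rightarrow> ('a \<Rightarrow> complex) set" where
  "weighted_lipschitz E r =
     {f. bdd_above ((\<lambda>v. real (depth E r v) * tree_deriv E r f v) ` {v. v \<noteq> r})}"

definition weighted_lipschitz_norm ::
  "('a \<Rightarrow> 'a \<Rightarrow> bool) \<Rightarrow> 'a \<Rightarrow> ('a \<Rightarrow> complex) \<Rightarrow> real" where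
  "weighted_lipschitz_norm E r f =
     cmod (f r) + (SUP v\<in>{v. v \<noteq> r}. real (depth E r v) * tree_deriv E r f v)"

text \<open>The filter \<open>filtercomap (depth E r) at_top\<close> expresses \<open>|v| \<rightarrow> \<infinity>\<close>.\<close>

definition little_weighted_lipschitz ::
  "('a \<Rightarrow> 'a \<Rightarrow> bool) \<Rightarrow> 'a \<Rightarrow> ('a \<Rightarrow> complex) set" where
  "little_weighted_lipschitz E r =
     {f \<in> weighted_lipschitz E r.
        ((\<lambda>v. real (depth E r v) * tree_deriv E r f v) \<longlongrightarrow> 0) (filtercomap (depth E r) at_top)}"

definition bounded_functions :: "('a \<Rightarrow> complex) set" where
  "bounded_functions = {f. bounded (range f)}"

definition sup_norm :: "('a \<Rightarrow> complex) \<Rightarrow> real" where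
  "sup_norm f = (SUP v. cmod (f v))"

definition mult_operator :: "('a \<Rightarrow> complex) \<Rightarrow> ('a \<Rightarrow> complex) \<Rightarrow> 'a \<Rightarrow> complex" where
  "mult_operator \<psi> f = (\<lambda>v. \<psi> v * f v)"

lemma cmod_le_sup_norm:
  assumes "f \<in> bounded_functions"
  shows "cmod (f v) \<le> sup_norm f"
proof -
  have "bdd_above (range (\<lambda>v. cmod (f v)))"
    using assms unfolding bounded_functions_def bounded_iff bdd_above_def by auto
  then show ?thesis
    unfolding sup_norm_def by (rule cSUP_upper[OF UNIV_I])
qed

lemma bounded_functions_diff:
  assumes "f \<in> bounded_functions" "g \<in> bounded_functions"
  shows "(\<lambda>v. f v - g v) \<in> bounded_functions"
  using assms bounded_minus_comp[of f UNIV g] unfolding bounded_functions_def by simp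

lemma Metric_space_bounded_functions:
  "Metric_space bounded_functions (norm_dist bounded_functions sup_norm)"
proof
  let ?d = "norm_dist bounded_functions sup_norm :: ('a \<Rightarrow> complex) \<Rightarrow> _"
  fix f g h :: "'a \<Rightarrow> complex"
  show "0 \<le> ?d f g"
    using order_trans[OF norm_ge_zero cmod_le_sup_norm[OF bounded_functions_diff]]
    unfolding norm_dist_def by auto
  show "?d f g = ?d g f"
    unfolding norm_dist_def sup_norm_def by (simp add: norm_minus_commute)
  assume fg: "f \<in> bounded_functions" "g \<in> bounded_functions"
  show "?d f g = 0 \<longleftrightarrow> f = g"
  proof
    assume "?d f g = 0"
    then have "cmod (f v - g v) \<le> 0" for v
      using fg cmod_le_sup_norm[OF bounded_functions_diff[OF fg], of v]
      unfolding norm_dist_def by simp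
    then show "f = g" by auto
  next
    assume "f = g"
    then show "?d f g = 0" unfolding norm_dist_def sup_norm_def by simp
  qed
  assume h: "h \<in> bounded_functions"
  have "cmod (f v - h v) \<le> sup_norm (\<lambda>v. f v - g v) + sup_norm (\<lambda>v. g v - h v)" for v
    using norm_diff_triangle_le[OF cmod_le_sup_norm[OF bounded_functions_diff[OF fg], of v]
        cmod_le_sup_norm[OF bounded_functions_diff[OF fg(2) h], of v]] .
  then show "?d f h \<le> ?d f g + ?d g h"
    using fg h unfolding norm_dist_def
    by (auto simp: sup_norm_def[of "\<lambda>v. f v - h v"] intro: cSUP_least)
qed

end

theory Submission
  imports Defs
begin

text \<open>Functions in the unit ball satisfy \<open>|f(v)| \<le> 1 + log |v|\<close>, and \<open>1 + log |v|\<close> is asymptotic to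
  \<open>log |v|\<close>. Replacing \<open>\<psi>\<close> by \<open>0\<close> on \<open>|v| \<ge> n\<close> gives a finite rank operator, and the norm of the
  remainder is asymptotically at most the supremum of \<open>log |v| |\<psi>(v)|\<close> over \<open>|v| \<ge> n\<close>.

  For the lower bound, let \<open>f\<^sub>k\<close> be radial with \<open>|v| Df\<^sub>k(v) = 1\<close> for \<open>m\<^sub>k < |v| \<le> n\<^sub>k\<close> and
  \<open>Df\<^sub>k = 0\<close> elsewhere, where \<open>n\<^sub>k \<le> m\<^bsub>k+1\<^esub>\<close>. All sums of distinct \<open>f\<^sub>k\<close> lie in the unit ball of the
  little space, so \<open>K f\<^sub>k\<close> cannot stay away from \<open>0\<close> for a compact operator \<open>K\<close>. If \<open>n\<^sub>k\<close> is large
  compared with \<open>m\<^sub>k\<close>, then \<open>f\<^sub>k \<approx> log n\<^sub>k\<close> on level \<open>n\<^sub>k\<close>, and this bounds \<open>\<parallel>M\<^sub>\<psi> - K\<parallel>\<close> from below.\<close>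

section \<open>Depth in a rooted tree\<close>

text \<open>Two paths that leave \<open>u\<close> along different edges and end at the same vertex
  close up to a cycle: follow the first until it first meets the second, then return along the
  second. A common first edge is stripped by induction.\<close>

lemma path_between_unique:
  assumes sym: "symp E" and acyc: "\<nexists>p. graph_cycle E p"
    and "path_between E u v p" "path_between E u v q"
  shows "p = q"
  using assms(3,4)
proof (induction p arbitrary: u q)
  case Nil
  then show ?case by (simp add: path_between_def)
next
  case (Cons a p)
  obtain q' where q: "q = u # q'" and a: "a = u"
    using Cons.prems by (cases q) (auto simp: path_between_def)
  have P: "last (u # p) = v" "distinct (u # p)" "successively E (u # p)"
    using Cons.prems(1) by (auto simp: path_between_def a)
  have Q: "last (u # q') = v" "distinct (u # q')" "successively E (u # q')"
    using Cons.prems(2) by (auto simp: path_between_def q)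
  show ?case
  proof (cases "p = [] \<or> q' = []")
    case True
    \<comment> \<open>An empty tail means \<open>v = u\<close>, and distinctness then empties the
      other tail.\<close>
    then have "p = [] \<and> q' = []"
      using P(1,2) Q(1,2) last_in_set[of p] last_in_set[of q'] by (auto split: if_splits)
    then show ?thesis by (simp add: a q)
  next
    case False
    show ?thesis
    proof (cases "hd p = hd q'")
      case True
      have "path_between E (hd p) v p" "path_between E (hd p) v q'"
        using P Q False True by (auto simp: path_between_def successively_Cons)
      then show ?thesis using Cons.IH by (simp add: a q)
    next
      case ne: False
      have "last p = v" "last q' = v" using P(1) Q(1) False by auto
      moreover have "last p \<in> set p" "last q' \<in> set q'" using False by auto
      ultimately have "\<exists>x\<in>set p. x \<in> set q'" by metis
      then obtain p1 x p2 where p: "p = p1 @ x # p2" and x: "x \<in> set q'"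
        and p1: "\<forall>y\<in>set p1. y \<notin> set q'"
        by (rule split_list_first_propE)
      obtain q1 q2 where q': "q' = q1 @ x # q2"
        using x by (meson split_list)
      let ?c = "u # p1 @ x # rev q1"
      have "distinct ?c" using P(2) Q(2) p1 by (auto simp: p q')
      \<comment> \<open>Since the first steps differ, \<open>p1\<close> and \<open>q1\<close> are
        not both empty, which gives the cycle its third vertex.\<close>
      moreover have "p1 \<noteq> [] \<or> q1 \<noteq> []" using ne by (auto simp: p q')
      then have "3 \<le> length ?c" by (cases p1; cases q1) auto
      moreover have "successively E (rev (q1 @ [x]))"
        using Q(3) sym
        by (auto simp: q' successively_Cons successively_append_iff symp_def hd_rev
            elim!: successively_mono)
      then have "successively E ?c"
        using P(3) by (auto simp: p successively_Cons successively_append_iff hd_append)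
      moreover have "E (last ?c) (hd ?c)"
        using Q(3) sym by (cases q1) (auto simp: q' successively_Cons symp_def)
      ultimately have "graph_cycle E ?c" unfolding graph_cycle_def by blast
      with acyc show ?thesis by blast
    qed
  qed
qed

text \<open>The sequence \<open>harm n - ln n\<close> decreases from its value 1 at
  \<open>n = 1\<close>.\<close>

lemma harm_le_ln:
  assumes "0 < n"
  shows "harm n \<le> 1 + ln (real n)"
  using decseqD[OF decseq_harm_diff_ln, of 0 "n - 1"] assms by (simp add: harm_def)

locale rooted_tree =
  fixes E :: "'a \<Rightarrow> 'a \<Rightarrow> bool" and r :: 'a
  assumes tree: "is_tree E" and infinite_vertices: "infinite (UNIV :: 'a set)"
begin

abbreviation dep :: "'a \<Rightarrow> nat" where "dep \<equiv> depth E r"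
abbreviation lipnorm :: "('a \<Rightarrow> complex) \<Rightarrow> real" where "lipnorm \<equiv> weighted_lipschitz_norm E r"

lemma edge_sym: "E u v \<Longrightarrow> E v u"
  using tree by (auto simp: is_tree_def symp_def)

text \<open>Uniqueness of paths makes the definite description in \<open>depth\<close>
  denote.\<close>

lemma depth_eq_length:
  assumes "path_between E r v p"
  shows "length p = Suc (dep v)"
proof -
  have uniq: "q = p" if "path_between E r v q" for q
    using path_between_unique[OF _ _ that assms] tree by (auto simp: is_tree_def)
  have "length p = Suc (length p - 1)" using assms by (cases p) (auto simp: path_between_def)
  then have "dep v = length p - 1"
    unfolding depth_def using assms uniq by (intro the_equality) (metis diff_Suc_1)+
  then show ?thesis using assms by (cases p) (auto simp: path_between_def)
qed

lemma root_path:
  obtains p where "path_between E r v p" "length p = Suc (dep v)"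
  using tree depth_eq_length unfolding is_tree_def by meson

lemma depth_root [simp]: "dep r = 0"
  using depth_eq_length[of r "[r]"] by (simp add: path_between_def)

text \<open>The path to \<open>w\<close> either passes through \<open>v\<close> and is cut there, or
  is prolonged by \<open>v\<close>.\<close>

lemma depth_le_Suc_neighbour:
  assumes "E w v"
  shows "dep v \<le> Suc (dep w)"
proof -
  obtain p where p: "path_between E r w p" "length p = Suc (dep w)" by (rule root_path)
  show ?thesis
  proof (cases "v \<in> set p")
    case True
    then obtain p1 p2 where p': "p = p1 @ v # p2" by (meson split_list)
    have "path_between E r v (p1 @ [v])"
      using p(1) by (auto simp: path_between_def p' successively_append_iff successively_Cons hd_append)
    then show ?thesis using depth_eq_length[of v "p1 @ [v]"] p(2) by (simp add: p')
  next
    case False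
    then have "path_between E r v (p @ [v])"
      using p(1) assms by (auto simp: path_between_def successively_append_iff)
    then show ?thesis using depth_eq_length[of v "p @ [v]"] p(2) by simp
  qed
qed

text \<open>The predecessor of \<open>v\<close> on its root path is a neighbour one level closer to
  the root. No neighbour is closer than that, so the minimiser chosen by \<open>parent\<close> lies
  on the same level.\<close>

lemma parent_props:
  assumes "v \<noteq> r"
  shows edge_parent: "E v (parent E r v)" and depth_parent: "dep v = Suc (dep (parent E r v))"
proof -
  obtain p where p: "path_between E r v p" "length p = Suc (dep v)" by (rule root_path)
  define q where "q = butlast p"
  have pq: "p = q @ [v]" using p(1) by (auto simp: path_between_def q_def)
  have q: "q \<noteq> []" using p(1) assms by (auto simp: path_between_def pq)
  have "path_between E r (last q) q" and e: "E v (last q)"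
    using p(1) q edge_sym by (auto simp: path_between_def pq successively_append_iff)
  then have "dep v = Suc (dep (last q))"
    using depth_eq_length[of "last q" q] p(2) by (simp add: pq)
  moreover have "E v (parent E r v)" "dep (parent E r v) \<le> dep (last q)"
    using arg_min_nat_lemma[of "E v", OF e, of dep] e unfolding parent_def by blast+
  moreover have "dep v \<le> Suc (dep (parent E r v))"
    using depth_le_Suc_neighbour edge_sym \<open>E v (parent E r v)\<close> by blast
  ultimately show "E v (parent E r v)" "dep v = Suc (dep (parent E r v))" by auto
qed

lemma depth_pos: "v \<noteq> r \<Longrightarrow> 0 < dep v"
  using depth_parent[of v] by simp

lemma finite_depth_less: "finite {v. dep v < n}"
proof (induction n)
  case (Suc n)
  \<comment> \<open>A nonroot vertex is adjacent to its parent, so local finiteness carries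
    finiteness to the next level.\<close>
  have "v \<in> insert r (\<Union>u\<in>{u. dep u < n}. {w. E u w})" if "dep v < Suc n" for v
    using that depth_parent[of v] edge_sym[OF edge_parent[of v]] by fastforce
  then have "{v. dep v < Suc n} \<subseteq> insert r (\<Union>u\<in>{u. dep u < n}. {w. E u w})" by blast
  moreover have "finite (insert r (\<Union>u\<in>{u. dep u < n}. {w. E u w}))"
    using Suc tree by (auto simp: is_tree_def)
  ultimately show ?case by (rule finite_subset)
qed simp

lemma ex_depth_ge: "\<exists>v. n \<le> dep v"
proof (rule ccontr)
  assume "\<not> ?thesis"
  then have "{v. dep v < n} = UNIV" by (auto simp: not_le)
  then show False using finite_depth_less[of n] infinite_vertices by simp
qed

text \<open>The supremum in the Lipschitz norm ranges over nonroot vertices; a real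
  \<open>SUP\<close> is meaningful only over a nonempty set.\<close>

lemma ex_nonroot: "\<exists>v. v \<noteq> r"
  using ex_depth_ge[of 1] depth_root not_one_le_zero by metis

section \<open>Growth of weighted Lipschitz functions\<close>

text \<open>The right-hand side is the Lipschitz seminorm, that is, the supremum term of the
  norm.\<close>

lemma tree_deriv_le:
  assumes "f \<in> weighted_lipschitz E r" "v \<noteq> r"
  shows "real (dep v) * tree_deriv E r f v \<le> lipnorm f - cmod (f r)"
  using assms unfolding weighted_lipschitz_def weighted_lipschitz_norm_def
  by (auto intro: cSUP_upper)

lemma cmod_root_le_lipnorm:
  assumes "f \<in> weighted_lipschitz E r"
  shows "cmod (f r) \<le> lipnorm f"
proof -
  obtain v where "v \<noteq> r" using ex_nonroot by blast
  moreover have "0 \<le> real (dep v) * tree_deriv E r f v" by (simp add: tree_deriv_def)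
  ultimately show ?thesis using tree_deriv_le[OF assms, of v] by linarith
qed

text \<open>Telescoping along the path from the root: the edge into level k changes \<open>f\<close>
  by at most the seminorm divided by k.\<close>

lemma cmod_le_harm:
  assumes "f \<in> weighted_lipschitz E r"
  shows "cmod (f v) \<le> cmod (f r) + harm (dep v) * (lipnorm f - cmod (f r))"
proof (induction "dep v" arbitrary: v)
  case 0
  then show ?case using depth_pos[of v] by (cases "v = r") (auto simp: harm_def)
next
  case (Suc n)
  let ?s = "lipnorm f - cmod (f r)"
  have v: "v \<noteq> r" using Suc.hyps(2) by auto
  define u where "u = parent E r v"
  have du: "dep u = n" using depth_parent[OF v] Suc.hyps(2) by (simp add: u_def)
  have "cmod (f v - f u) \<le> ?s / real (dep v)"
    using tree_deriv_le[OF assms v] depth_pos[OF v]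
    by (simp add: tree_deriv_def u_def field_simps)
  moreover have "cmod (f u) \<le> cmod (f r) + harm n * ?s"
    using Suc.hyps(1)[of u] du by simp
  moreover have "cmod (f v) \<le> cmod (f u) + cmod (f v - f u)"
    by (metis add.commute diff_add_cancel norm_triangle_ineq)
  moreover have "harm (dep v) * ?s = harm n * ?s + ?s / real (dep v)"
    unfolding Suc.hyps(2)[symmetric] harm_Suc by (simp add: algebra_simps divide_simps)
  ultimately show ?case by linarith
qed

lemma cmod_le_ln:
  assumes "f \<in> weighted_lipschitz E r" "lipnorm f \<le> 1" "0 < dep v"
  shows "cmod (f v) \<le> 1 + ln (real (dep v))"
proof -
  have 1: "1 \<le> (harm (dep v) :: real)"
    using harm_mono[of 1 "dep v", where 'a=real] assms(3) by (simp add: harm_def)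
  have "cmod (f v) \<le> cmod (f r) + harm (dep v) * (1 - cmod (f r))"
    using cmod_le_harm[OF assms(1), of v] assms(2) 1
      mult_left_mono[of "lipnorm f - cmod (f r)" "1 - cmod (f r)" "harm (dep v)"] by linarith
  \<comment> \<open>With h the harmonic number and t = |f(r)|, t + h(1 - t) = h - (h - 1)t \<le> h
    because h \<ge> 1.\<close>
  also have "\<dots> \<le> harm (dep v)"
    using mult_right_mono[OF 1, of "cmod (f r)"] by (simp add: algebra_simps)
  finally show ?thesis using harm_le_ln[OF assms(3)] by linarith
qed

text \<open>Point evaluations are bounded functionals; this form scales with the norm, as the bound
  in \<open>bounded_operator\<close> requires.\<close>

lemma cmod_le_lipnorm:
  assumes "f \<in> weighted_lipschitz E r"
  shows "cmod (f v) \<le> (1 + harm (dep v)) * lipnorm f"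
proof -
  have "harm (dep v) * (lipnorm f - cmod (f r)) \<le> harm (dep v) * lipnorm f"
    by (intro mult_left_mono) (auto intro: harm_nonneg)
  then show ?thesis
    using cmod_le_harm[OF assms, of v] cmod_root_le_lipnorm[OF assms] by (simp add: algebra_simps)
qed

end

section \<open>Truncated multiplication operators\<close>

lemma sup_norm_le: "(\<And>v. cmod (f v) \<le> c) \<Longrightarrow> sup_norm f \<le> c"
  unfolding sup_norm_def by (rule cSUP_least) auto

lemma finite_support_bounded:
  assumes "finite {v. f v \<noteq> 0}"
  shows "f \<in> bounded_functions"
proof -
  have "range f \<subseteq> insert 0 (f ` {v. f v \<noteq> 0})" by auto
  then have "finite (range f)" using assms finite_subset by auto
  then show ?thesis by (simp add: bounded_functions_def finite_imp_bounded)
qed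

text \<open>Bolzano-Weierstrass, one point at a time: each further extraction preserves the limits
  already obtained.\<close>

lemma pointwise_convergent_subsequence:
  fixes \<sigma> :: "nat \<Rightarrow> 'a \<Rightarrow> complex"
  assumes "finite A" "\<And>n v. v \<in> A \<Longrightarrow> cmod (\<sigma> n v) \<le> R v"
  shows "\<exists>l s. strict_mono (s :: nat \<Rightarrow> nat) \<and> (\<forall>v\<in>A. (\<lambda>n. \<sigma> (s n) v) \<longlonglongrightarrow> l v)"
  using assms
proof (induction A rule: finite_induct)
  case empty
  then show ?case using strict_mono_id by blast
next
  case (insert a A)
  then have "\<exists>l s. strict_mono (s :: nat \<Rightarrow> nat) \<and> (\<forall>v\<in>A. (\<lambda>n. \<sigma> (s n) v) \<longlonglongrightarrow> l v)"
    by simp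
  then obtain l s where s: "strict_mono (s :: nat \<Rightarrow> nat)" and l: "\<And>v. v \<in> A \<Longrightarrow> (\<lambda>n. \<sigma> (s n) v) \<longlonglongrightarrow> l v"
    by blast
  have "bounded (range (\<lambda>n. \<sigma> (s n) a))"
    using insert.prems[of a] by (auto simp: bounded_iff)
  then obtain l' s' where s': "strict_mono (s' :: nat \<Rightarrow> nat)" and l': "(\<lambda>n. \<sigma> (s (s' n)) a) \<longlonglongrightarrow> l'"
    using bounded_imp_convergent_subsequence[of "\<lambda>n. \<sigma> (s n) a"] unfolding o_def by blast
  have "(\<lambda>n. \<sigma> ((s \<circ> s') n) v) \<longlonglongrightarrow> (l(a := l')) v" if "v \<in> insert a A" for v
    using that l' LIMSEQ_subseq_LIMSEQ[OF l s', of v] insert.hyps by (auto simp: o_def)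
  then show ?case using strict_mono_o[OF s s'] by blast
qed

text \<open>The set is a closed box in a finite-dimensional space. Sequential compactness suffices,
  and pointwise convergence on the finite set \<open>A\<close> is uniform.\<close>

lemma compactin_finitely_supported:
  assumes A: "finite A"
  shows "compactin (norm_topology bounded_functions sup_norm)
    {g. \<forall>v. (v \<in> A \<longrightarrow> cmod (g v) \<le> R v) \<and> (v \<notin> A \<longrightarrow> g v = 0)}" (is "compactin _ ?P")
proof -
  interpret B: Metric_space bounded_functions "norm_dist bounded_functions sup_norm :: ('a \<Rightarrow> complex) \<Rightarrow> _"
    by (rule Metric_space_bounded_functions)
  have P: "g \<in> bounded_functions" if "g \<in> ?P" for g
    using that A by (intro finite_support_bounded) (auto intro: finite_subset[of _ A])
  have "\<exists>l s. l \<in> ?P \<and> strict_mono s \<and> limitin B.mtopology (\<sigma> \<circ> s) l sequentially"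
    if \<sigma>: "range \<sigma> \<subseteq> ?P" for \<sigma> :: "nat \<Rightarrow> 'a \<Rightarrow> complex"
  proof -
    have \<sigma>': "v \<in> A \<Longrightarrow> cmod (\<sigma> n v) \<le> R v" "v \<notin> A \<Longrightarrow> \<sigma> n v = 0" for n v
      using \<sigma> by auto
    obtain l s where s: "strict_mono (s :: nat \<Rightarrow> nat)"
      and l: "\<And>v. v \<in> A \<Longrightarrow> (\<lambda>n. \<sigma> (s n) v) \<longlonglongrightarrow> l v"
      using pointwise_convergent_subsequence[OF A, of \<sigma> R] \<sigma>'(1) by blast
    define g where "g = (\<lambda>v. if v \<in> A then l v else 0)"
    have "cmod (l v) \<le> R v" if "v \<in> A" for v
      by (rule LIMSEQ_le_const2[OF tendsto_norm[OF l[OF that]]]) (use \<sigma>'(1) that in blast)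
    then have g: "g \<in> ?P" by (simp add: g_def)
    have "\<forall>\<^sub>F n in sequentially. norm_dist bounded_functions sup_norm (\<sigma> (s n)) g < e" if "0 < e" for e
    proof -
      have "\<forall>\<^sub>F n in sequentially. \<forall>v\<in>A. dist (\<sigma> (s n) v) (l v) < e / 2"
        using A l \<open>0 < e\<close> by (intro eventually_ball_finite ballI tendstoD) simp_all
      then show ?thesis
      proof eventually_elim
        case (elim n)
        \<comment> \<open>A supremum of values below \<open>e / 2\<close> may equal
          \<open>e / 2\<close>; halving keeps the final inequality strict.\<close>
        have "cmod (\<sigma> (s n) v - g v) \<le> e / 2" for v
          using elim \<sigma>'(2) \<open>0 < e\<close> by (cases "v \<in> A") (auto simp: g_def dist_norm less_imp_le)
        then have "sup_norm (\<lambda>v. \<sigma> (s n) v - g v) \<le> e / 2" by (rule sup_norm_le)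
        then show ?case using P g \<sigma> \<open>0 < e\<close> by (auto simp: norm_dist_def)
      qed
    qed
    moreover have "\<sigma> n \<in> bounded_functions" for n using P \<sigma> by blast
    ultimately have "limitin B.mtopology (\<sigma> \<circ> s) g sequentially"
      using P[OF g] by (simp add: B.limitin_metric)
    with g s show ?thesis by blast
  qed
  then show ?thesis
    unfolding norm_topology_def B.compactin_sequentially using P by (intro conjI subsetI allI impI) simp_all
qed

context rooted_tree begin

text \<open>Bounded point evaluations place the image of the unit ball in a box over the finite
  support of \<open>\<phi>\<close>. The box is compact, hence closed, and so contains the closure of
  the image as a closed subset.\<close>

lemma compact_mult_operator_finite_support:
  assumes X: "X \<subseteq> weighted_lipschitz E r" and A: "finite {v. \<phi> v \<noteq> 0}"
  shows "compact_operator X lipnorm bounded_functions sup_norm (mult_operator \<phi>)"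
proof -
  define c where "c = (\<lambda>v. cmod (\<phi> v) * (1 + harm (dep v)))"
  have c0: "0 \<le> c v" for v by (simp add: c_def harm_nonneg)
  have bd: "cmod (mult_operator \<phi> f v) \<le> c v * lipnorm f" if "f \<in> X" for f v
    using mult_left_mono[OF cmod_le_lipnorm[of f v], of "cmod (\<phi> v)"] X that
    by (auto simp: mult_operator_def norm_mult c_def mult.assoc)
  have mem: "mult_operator \<phi> f \<in> bounded_functions" for f
    using A by (intro finite_support_bounded) (auto simp: mult_operator_def intro: finite_subset[rotated])
  have "\<exists>C. \<forall>f\<in>X. sup_norm (mult_operator \<phi> f) \<le> C * lipnorm f"
  proof (intro exI ballI sup_norm_le)
    fix f v assume f: "f \<in> X"
    have n: "0 \<le> lipnorm f" using cmod_root_le_lipnorm[of f] X f by (force intro: order_trans[OF norm_ge_zero])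
    \<comment> \<open>The sum over the support serves as a bound uniform in \<open>v\<close>; off
      the support \<open>c\<close> vanishes.\<close>
    have "c v \<le> sum c {v. \<phi> v \<noteq> 0}"
    proof (cases "\<phi> v = 0")
      case True
      then show ?thesis by (simp add: c_def sum_nonneg harm_nonneg)
    next
      case False
      then show ?thesis using A c0 by (intro member_le_sum) auto
    qed
    then show "cmod (mult_operator \<phi> f v) \<le> sum c {v. \<phi> v \<noteq> 0} * lipnorm f"
      using bd[OF f, of v] mult_right_mono[OF _ n, of "c v" "sum c {v. \<phi> v \<noteq> 0}"] by linarith
  qed
  then have bop: "bounded_operator X lipnorm bounded_functions sup_norm (mult_operator \<phi>)"
    using mem by (auto simp: bounded_operator_def mult_operator_def algebra_simps)
  let ?T = "norm_topology bounded_functions sup_norm :: ('a \<Rightarrow> complex) topology"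
  let ?P = "{g. \<forall>v. (v \<in> {v. \<phi> v \<noteq> 0} \<longrightarrow> cmod (g v) \<le> c v) \<and> (v \<notin> {v. \<phi> v \<noteq> 0} \<longrightarrow> g v = 0)}"
  have P: "compactin ?T ?P" by (rule compactin_finitely_supported[OF A])
  have "cmod (mult_operator \<phi> f v) \<le> c v" if "f \<in> X" "lipnorm f \<le> 1" for f v
    using bd[OF that(1), of v] mult_left_mono[OF that(2) c0[of v]] by simp
  then have "mult_operator \<phi> ` {f \<in> X. lipnorm f \<le> 1} \<subseteq> ?P"
    by (auto simp: mult_operator_def)
  moreover have "Hausdorff_space ?T"
    unfolding norm_topology_def
    by (rule Metric_space.Hausdorff_space_mtopology[OF Metric_space_bounded_functions])
  then have "closedin ?T ?P" using P by (rule compactin_imp_closedin)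
  ultimately have "?T closure_of (mult_operator \<phi> ` {f \<in> X. lipnorm f \<le> 1}) \<subseteq> ?P"
    by (rule closure_of_minimal)
  then show ?thesis
    unfolding compact_operator_def using bop P closed_compactin closedin_closure_of by blast
qed

section \<open>Test functions\<close>

text \<open>The weighted derivative \<open>|v| Df(v)\<close> of \<open>f = level_sum S\<close> is the indicator of the levels in \<open>S\<close>, so
  the functions of disjoint sets of levels add up without leaving the unit ball.\<close>

definition level_sum :: "nat set \<Rightarrow> 'a \<Rightarrow> complex" where
  "level_sum S v = of_real (\<Sum>k\<in>S \<inter> {1..dep v}. inverse (real k))"

lemma level_sum_empty: "level_sum {} = (\<lambda>v. 0)"
  by (simp add: level_sum_def fun_eq_iff)

lemma level_sum_Un_disjoint:
  assumes "S \<inter> T = {}"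
  shows "level_sum (S \<union> T) = (\<lambda>v. level_sum S v + level_sum T v)"
proof
  fix v
  have "(S \<union> T) \<inter> {1..dep v} = (S \<inter> {1..dep v}) \<union> (T \<inter> {1..dep v})" by blast
  then show "level_sum (S \<union> T) v = level_sum S v + level_sum T v"
    using assms unfolding level_sum_def of_real_add[symmetric]
    by (subst sum.union_disjoint[symmetric]) auto
qed

lemma level_sum_interval:
  assumes "m \<le> dep v"
  shows "level_sum {m<..dep v} v = of_real (harm (dep v) - harm m)"
proof -
  have "{1..dep v} = {1..m} \<union> {m<..dep v}" "{m<..dep v} \<inter> {1..dep v} = {m<..dep v}"
    using assms by auto
  moreover have "{1..m} \<inter> {m<..dep v} = {}" by auto
  ultimately show ?thesis
    by (simp add: level_sum_def harm_def sum.union_disjoint)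
qed

lemma tree_deriv_level_sum:
  assumes "v \<noteq> r"
  shows "real (dep v) * tree_deriv E r (level_sum S) v = (if dep v \<in> S then 1 else 0)"
proof -
  \<comment> \<open>Compared with the parent, only the summand of the level of \<open>v\<close>
    itself can be new.\<close>
  have "S \<inter> {1..Suc n} = (if Suc n \<in> S then insert (Suc n) (S \<inter> {1..n}) else S \<inter> {1..n})" for n
    by (auto simp: le_Suc_eq)
  then show ?thesis
    unfolding tree_deriv_def level_sum_def of_real_diff[symmetric] norm_of_real
    unfolding depth_parent[OF assms] by (simp del: of_nat_Suc)
qed

lemma level_sum_props:
  assumes "finite S"
  shows level_sum_mem: "level_sum S \<in> little_weighted_lipschitz E r"
    and lipnorm_level_sum: "lipnorm (level_sum S) \<le> 1"
proof -
  have le: "real (dep v) * tree_deriv E r (level_sum S) v \<le> 1" if "v \<noteq> r" for v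
    using tree_deriv_level_sum[OF that] by simp
  have "\<forall>\<^sub>F v in filtercomap dep at_top. real (dep v) * tree_deriv E r (level_sum S) v = 0"
    unfolding eventually_filtercomap
  proof (intro exI conjI allI impI)
    \<comment> \<open>Inserting 0 makes \<open>Max\<close> meaningful for empty \<open>S\<close> and
      excludes the root.\<close>
    show "\<forall>\<^sub>F n in at_top. Max (insert 0 S) < n" by (rule eventually_gt_at_top)
    fix v assume v: "Max (insert 0 S) < dep v"
    then have "v \<noteq> r" by auto
    moreover have "dep v \<notin> S" using v assms by (metis Max_ge finite_insert insertCI not_le)
    ultimately show "real (dep v) * tree_deriv E r (level_sum S) v = 0"
      by (simp add: tree_deriv_level_sum)
  qed
  then have "((\<lambda>v. real (dep v) * tree_deriv E r (level_sum S) v) \<longlongrightarrow> 0) (filtercomap dep at_top)"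
    by (rule tendsto_eventually)
  then show "level_sum S \<in> little_weighted_lipschitz E r"
    using le by (auto simp: little_weighted_lipschitz_def weighted_lipschitz_def bdd_above_def)
  have "(SUP v\<in>{v. v \<noteq> r}. real (dep v) * tree_deriv E r (level_sum S) v) \<le> 1"
    using ex_nonroot le by (intro cSUP_least) auto
  then show "lipnorm (level_sum S) \<le> 1"
    by (simp add: weighted_lipschitz_norm_def level_sum_def)
qed

section \<open>Bounded and compact operators on level sums\<close>

lemma operator_level_sum_UN:
  assumes K: "bounded_operator X lipnorm Y nY K" and X: "little_weighted_lipschitz E r \<subseteq> X"
    and "finite F" "\<And>k. finite (A k)" "disjoint_family A"
  shows "K (level_sum (\<Union>k\<in>F. A k)) w = (\<Sum>k\<in>F. K (level_sum (A k)) w)"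
  using \<open>finite F\<close>
proof (induction F rule: finite_induct)
  case empty
  \<comment> \<open>Homogeneity with scalar 0 shows that \<open>K\<close> maps the zero function to
    zero.\<close>
  have "level_sum {} \<in> X" using X level_sum_mem by blast
  then have "K (\<lambda>v. 0 * level_sum {} v) = (\<lambda>w. 0 * K (level_sum {}) w)"
    using K unfolding bounded_operator_def by blast
  then show ?case by (simp add: level_sum_empty)
next
  case (insert a F)
  have "A a \<inter> A k = {}" if "k \<in> F" for k
    using \<open>disjoint_family A\<close> insert.hyps(2) that by (metis UNIV_I disjoint_family_onD)
  then have "A a \<inter> (\<Union>k\<in>F. A k) = {}" by blast
  then have "level_sum (\<Union>k\<in>insert a F. A k) = (\<lambda>v. level_sum (A a) v + level_sum (\<Union>k\<in>F. A k) v)"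
    by (simp add: level_sum_Un_disjoint)
  moreover have "level_sum (A a) \<in> X" "level_sum (\<Union>k\<in>F. A k) \<in> X"
    using X level_sum_mem[OF assms(4)[of a]] level_sum_mem[OF finite_UN_I[OF insert.hyps(1) assms(4)]]
    by auto
  ultimately have "K (level_sum (\<Union>k\<in>insert a F. A k)) =
      (\<lambda>w. K (level_sum (A a)) w + K (level_sum (\<Union>k\<in>F. A k)) w)"
    using K unfolding bounded_operator_def by simp
  then show ?case using insert by simp
qed

lemma bounded_operator_level_sum:
  assumes K: "bounded_operator X lipnorm bounded_functions sup_norm K"
    and X: "little_weighted_lipschitz E r \<subseteq> X"
  obtains C where "\<And>S w. finite S \<Longrightarrow> cmod (K (level_sum S) w) \<le> C"
proof -
  obtain C where C: "\<And>f. f \<in> X \<Longrightarrow> K f \<in> bounded_functions \<and> sup_norm (K f) \<le> C * lipnorm f"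
    using K unfolding bounded_operator_def by blast
  \<comment> \<open>\<open>C\<close> is not known to be nonnegative; its absolute value permits
    replacing the norm by 1.\<close>
  have "cmod (K (level_sum S) w) \<le> \<bar>C\<bar>" if "finite S" for S w
  proof -
    have S: "level_sum S \<in> X" "level_sum S \<in> weighted_lipschitz E r"
      using X level_sum_mem[OF that] by (auto simp: little_weighted_lipschitz_def)
    have "cmod (K (level_sum S) w) \<le> C * lipnorm (level_sum S)"
      using C[OF S(1)] cmod_le_sup_norm[of "K (level_sum S)" w] by linarith
    also have "\<dots> \<le> \<bar>C\<bar> * 1"
      using lipnorm_level_sum[OF that] order_trans[OF norm_ge_zero cmod_root_le_lipnorm[OF S(2)]]
      by (intro mult_mono) auto
    finally show ?thesis by simp
  qed
  then show ?thesis using that by blast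
qed

text \<open>By pigeonhole in a finite net of the relatively compact image of the unit ball, infinitely many
  of the images \<open>K f\<^sub>k\<close> lie close to a single \<open>K f\<^sub>j\<close>. If this one were at least \<open>\<delta>\<close> at some vertex, the
  images of the sums of many of the \<open>f\<^sub>k\<close> would be unbounded there, although these sums stay in the
  unit ball.\<close>

lemma compact_operator_level_sum_small:
  fixes K :: "('a \<Rightarrow> complex) \<Rightarrow> 'b \<Rightarrow> complex"
  assumes K: "compact_operator X lipnorm bounded_functions sup_norm K"
    and X: "little_weighted_lipschitz E r \<subseteq> X"
    and A: "\<And>k. finite (A k)" "disjoint_family A" and "0 < \<delta>"
  shows "\<exists>k :: nat. \<forall>w. cmod (K (level_sum (A k)) w) < \<delta>"
proof (rule ccontr)
  assume "\<not> ?thesis"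
  then obtain w where w: "\<And>k. \<delta> \<le> cmod (K (level_sum (A k)) (w k))"
    by (meson not_le)
  have bop: "bounded_operator X lipnorm bounded_functions sup_norm K"
    using K by (simp add: compact_operator_def)
  interpret B: Metric_space bounded_functions "norm_dist bounded_functions sup_norm :: ('b \<Rightarrow> complex) \<Rightarrow> _"
    by (rule Metric_space_bounded_functions)
  let ?g = "\<lambda>k. K (level_sum (A k))"
  let ?I = "K ` {f \<in> X. lipnorm f \<le> 1}"
  have I: "?I \<subseteq> bounded_functions" using bop by (auto simp: bounded_operator_def)
  have "level_sum (A k) \<in> {f \<in> X. lipnorm f \<le> 1}" for k
    using X level_sum_mem[OF A(1)] lipnorm_level_sum[OF A(1)] by blast
  then have gI: "?g k \<in> ?I" for k by blast
  have "B.mtotally_bounded (B.mtopology closure_of ?I)"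
    using K B.compactin_imp_mtotally_bounded unfolding compact_operator_def norm_topology_def by simp
  \<comment> \<open>Images in a common ball of radius \<open>\<delta> / 4\<close> differ by at most
    \<open>\<delta> / 2\<close> at each vertex, half of the assumed size
    \<open>\<delta>\<close>.\<close>
  moreover have "0 < \<delta> / 4" using \<open>0 < \<delta>\<close> by simp
  ultimately obtain N where N: "finite N" "B.mtopology closure_of ?I \<subseteq> (\<Union>x\<in>N. B.mball x (\<delta> / 4))"
    unfolding B.mtotally_bounded_def by blast
  have "?I \<subseteq> B.mtopology closure_of ?I"
    using I by (simp add: closure_of_subset)
  then have "\<forall>k\<in>UNIV. \<exists>x\<in>N. ?g k \<in> B.mball x (\<delta> / 4)"
    using N(2) gI by blast
  then obtain x where x: "infinite {k \<in> UNIV. ?g k \<in> B.mball x (\<delta> / 4)}"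
    using pigeonhole_infinite_rel[of "UNIV :: nat set" N "\<lambda>k x. ?g k \<in> B.mball x (\<delta> / 4)"] N(1) by auto
  let ?J = "{k. ?g k \<in> B.mball x (\<delta> / 4)}"
  have J: "infinite ?J" using x by simp
  then obtain j where j: "j \<in> ?J" using not_finite_existsD by blast
  define z where "z = ?g j (w j)"
  have z: "\<delta> \<le> cmod z" using w by (simp add: z_def)
  have close: "cmod (?g k (w j) - z) \<le> \<delta> / 2" if "k \<in> ?J" for k
  proof -
    have "cmod (?g i (w j) - x (w j)) \<le> \<delta> / 4" if "i \<in> ?J" for i
    proof -
      have "x \<in> bounded_functions" "?g i \<in> bounded_functions" "norm_dist bounded_functions sup_norm (?g i) x < \<delta> / 4"
        using that by (auto simp: B.commute)
      then show ?thesis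
        using cmod_le_sup_norm[OF bounded_functions_diff[of "?g i" x], of "w j"] by (simp add: norm_dist_def)
    qed
    from this[OF that] this[OF j] show ?thesis
      unfolding z_def using norm_diff_triangle_le[of "?g k (w j)" "x (w j)" "\<delta> / 4" "?g j (w j)" "\<delta> / 4"]
      by (simp add: norm_minus_commute)
  qed
  obtain C where C: "\<And>S w. finite S \<Longrightarrow> cmod (K (level_sum S) w) \<le> C"
    using bounded_operator_level_sum[OF bop X] by blast
  obtain n :: nat where n: "C / (\<delta> / 2) < real n" using reals_Archimedean2 by blast
  obtain F where F: "finite F" "card F = n" "F \<subseteq> ?J"
    using infinite_arbitrarily_large[OF J] by blast
  have "K (level_sum (\<Union>k\<in>F. A k)) (w j) = (\<Sum>k\<in>F. ?g k (w j))"
    by (rule operator_level_sum_UN[OF bop X F(1) A])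
  \<comment> \<open>The main term has modulus at least n\<open>\<delta>\<close> and the deviations
    total at most n\<open>\<delta>\<close>/2, so the sum has modulus at least
    n\<open>\<delta>\<close>/2, which exceeds \<open>C\<close>.\<close>
  also have "\<dots> = of_nat n * z + (\<Sum>k\<in>F. ?g k (w j) - z)"
    using F(2) by (simp add: sum_subtractf)
  finally have "cmod (of_nat n * z) \<le> cmod (K (level_sum (\<Union>k\<in>F. A k)) (w j)) + cmod (\<Sum>k\<in>F. ?g k (w j) - z)"
    by (metis add_diff_cancel_right' norm_triangle_ineq4)
  moreover have "cmod (\<Sum>k\<in>F. ?g k (w j) - z) \<le> real n * (\<delta> / 2)"
    using sum_norm_bound[of F "\<lambda>k. ?g k (w j) - z" "\<delta> / 2"] close F by auto
  moreover have "cmod (K (level_sum (\<Union>k\<in>F. A k)) (w j)) \<le> C"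
    using F(1) A(1) by (intro C) blast
  moreover have "real n * \<delta> \<le> cmod (of_nat n * z)"
    using z by (simp add: norm_mult mult_left_mono)
  ultimately have "real n * (\<delta> / 2) \<le> C" by (simp add: algebra_simps)
  then show False using n \<open>0 < \<delta>\<close> by (simp add: field_simps)
qed

section \<open>The essential norm\<close>

lemma bounded_operator_diff:
  assumes "bounded_operator X lipnorm bounded_functions sup_norm S"
    and "bounded_operator X lipnorm bounded_functions sup_norm T"
  shows "bounded_operator X lipnorm bounded_functions sup_norm (\<lambda>f w. S f w - T f w)"
proof -
  obtain C where C: "\<And>f. f \<in> X \<Longrightarrow> S f \<in> bounded_functions \<and> sup_norm (S f) \<le> C * lipnorm f"
    using assms(1) unfolding bounded_operator_def by blast
  obtain D where D: "\<And>f. f \<in> X \<Longrightarrow> T f \<in> bounded_functions \<and> sup_norm (T f) \<le> D * lipnorm f"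
    using assms(2) unfolding bounded_operator_def by blast
  have "sup_norm (\<lambda>w. S f w - T f w) \<le> (C + D) * lipnorm f" if "f \<in> X" for f
  proof (rule sup_norm_le)
    fix w
    have "cmod (S f w) \<le> C * lipnorm f" "cmod (T f w) \<le> D * lipnorm f"
      using C[OF that] D[OF that] cmod_le_sup_norm[of "S f" w] cmod_le_sup_norm[of "T f" w] by linarith+
    then show "cmod (S f w - T f w) \<le> (C + D) * lipnorm f"
      using norm_triangle_ineq4[of "S f w" "T f w"] by (simp add: algebra_simps)
  qed
  then have "\<exists>C. \<forall>f\<in>X. sup_norm (\<lambda>w. S f w - T f w) \<le> C * lipnorm f" by blast
  moreover have "(\<lambda>w. S f w - T f w) \<in> bounded_functions" if "f \<in> X" for f
    using C[OF that] D[OF that] by (intro bounded_functions_diff) auto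
  ultimately show ?thesis
    using assms unfolding bounded_operator_def by (simp add: algebra_simps)
qed

lemma sup_norm_le_operator_norm:
  assumes X: "X \<subseteq> weighted_lipschitz E r"
    and S: "bounded_operator X lipnorm bounded_functions sup_norm S"
    and f: "f \<in> X" "lipnorm f \<le> 1"
  shows "sup_norm (S f) \<le> operator_norm X lipnorm sup_norm S"
proof -
  obtain C where C: "\<And>f. f \<in> X \<Longrightarrow> sup_norm (S f) \<le> C * lipnorm f"
    using S unfolding bounded_operator_def by blast
  have "sup_norm (S f) \<le> \<bar>C\<bar>" if "f \<in> X" "lipnorm f \<le> 1" for f
  proof -
    have "0 \<le> lipnorm f"
      using cmod_root_le_lipnorm[of f] X that(1) by (force intro: order_trans[OF norm_ge_zero])
    then have "C * lipnorm f \<le> \<bar>C\<bar> * 1" using that by (intro mult_mono) auto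
    then show ?thesis using C[OF that(1)] by simp
  qed
  then have "bdd_above ((\<lambda>f. sup_norm (S f)) ` {f \<in> X. lipnorm f \<le> 1})"
    by (auto simp: bdd_above_def)
  then show ?thesis
    unfolding operator_norm_def using f by (intro cSUP_upper) auto
qed

lemma cmod_le_operator_norm:
  assumes X: "X \<subseteq> weighted_lipschitz E r"
    and S: "bounded_operator X lipnorm bounded_functions sup_norm S"
    and f: "f \<in> X" "lipnorm f \<le> 1"
  shows "cmod (S f w) \<le> operator_norm X lipnorm sup_norm S"
proof -
  have "S f \<in> bounded_functions" using S f(1) by (simp add: bounded_operator_def)
  then show ?thesis
    using cmod_le_sup_norm[of "S f" w] sup_norm_le_operator_norm[OF assms] by linarith
qed

text \<open>This bounds the infimum in \<open>essential_norm\<close> from below; the zero function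
  \<open>level_sum {}\<close> lies in the unit ball.\<close>

lemma operator_norm_nonneg:
  assumes "X \<subseteq> weighted_lipschitz E r" "little_weighted_lipschitz E r \<subseteq> X"
    and "bounded_operator X lipnorm bounded_functions sup_norm S"
  shows "0 \<le> operator_norm X lipnorm sup_norm S"
proof -
  have "level_sum {} \<in> X" "lipnorm (level_sum {}) \<le> 1"
    using assms(2) level_sum_mem lipnorm_level_sum by blast+
  then show ?thesis
    using order_trans[OF norm_ge_zero cmod_le_operator_norm[OF assms(1,3)]] by blast
qed

text \<open>A gliding hump: test functions on successive blocks of levels are multiplied by
  \<open>\<psi>\<close> to nearly \<open>c\<close> or more at a vertex on top of their block, while
  \<open>K\<close> is small on at least one of them.\<close>

lemma operator_norm_compact_perturbation_ge:
  assumes X: "X \<subseteq> weighted_lipschitz E r" "little_weighted_lipschitz E r \<subseteq> X"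
    and M: "bounded_operator X lipnorm bounded_functions sup_norm (mult_operator \<psi>)"
    and K: "compact_operator X lipnorm bounded_functions sup_norm K"
    and c: "\<And>n. \<exists>v. n \<le> dep v \<and> c < ln (real (dep v)) * cmod (\<psi> v)"
  shows "c \<le> operator_norm X lipnorm sup_norm (\<lambda>f w. mult_operator \<psi> f w - K f w)"
    (is "c \<le> ?B")
proof (rule ccontr)
  assume "\<not> c \<le> ?B"
  \<comment> \<open>Half the gap: one \<open>\<delta>\<close> pays for the start of the block, the
    other for \<open>K\<close>.\<close>
  define \<delta> where "\<delta> = (c - ?B) / 2"
  have \<delta>: "0 < \<delta>" using \<open>\<not> c \<le> ?B\<close> by (simp add: \<delta>_def)
  have diff: "bounded_operator X lipnorm bounded_functions sup_norm (\<lambda>f w. mult_operator \<psi> f w - K f w)"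
    using bounded_operator_diff[OF M] K by (simp add: compact_operator_def)
  obtain C where C: "\<And>S w. finite S \<Longrightarrow> cmod (mult_operator \<psi> (level_sum S) w) \<le> C"
    using bounded_operator_level_sum[OF M X(2)] by blast
  \<comment> \<open>Testing on all levels up to \<open>dep w\<close> shows that
    \<open>\<psi>\<close> decays at least like 1/\<open>harm\<close>; hence
    \<open>cmod (\<psi> v) * harm m\<close> is small for \<open>v\<close> deep relative to
    \<open>m\<close>.\<close>
  have psi: "cmod (\<psi> w) * harm (dep w) \<le> C" for w
    using C[of "{0<..dep w}" w] level_sum_interval[of 0 w]
    by (simp add: mult_operator_def norm_mult harm_expand norm_harm)
  have step: "\<exists>v. m < dep v \<and> c - \<delta> \<le> cmod (\<psi> v) * (harm (dep v) - harm m)" for m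
  proof -
    have "\<forall>\<^sub>F n in sequentially. C * harm m / \<delta> \<le> (harm n :: real)"
      using harm_at_top[unfolded filterlim_at_top] by blast
    then obtain n0 where n0: "\<And>n. n0 \<le> n \<Longrightarrow> C * harm m / \<delta> \<le> (harm n :: real)"
      unfolding eventually_sequentially by blast
    obtain v where v: "max (Suc m) n0 \<le> dep v" "c < ln (real (dep v)) * cmod (\<psi> v)"
      using c by blast
    have pos: "0 < (harm (dep v) :: real)" using v(1) by (intro harm_pos) simp
    have "ln (real (dep v)) \<le> ln (real (dep v) + 1)" using v(1) by simp
    then have "ln (real (dep v)) \<le> harm (dep v)" using ln_le_harm[of "dep v"] by linarith
    then have "c < cmod (\<psi> v) * harm (dep v)"
      using v(2) mult_right_mono[of "ln (real (dep v))" "harm (dep v)" "cmod (\<psi> v)"]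
      by (simp add: mult.commute)
    moreover have "cmod (\<psi> v) * harm m \<le> \<delta>"
    proof -
      have "cmod (\<psi> v) * harm m * harm (dep v) \<le> C * harm m"
        using mult_right_mono[OF psi[of v] harm_nonneg[of m]] by (simp add: mult_ac)
      also have "\<dots> \<le> \<delta> * harm (dep v)"
        using n0[of "dep v"] v(1) \<delta> by (simp add: field_simps)
      finally show ?thesis using pos by simp
    qed
    ultimately have "c - \<delta> \<le> cmod (\<psi> v) * (harm (dep v) - harm m)"
      by (simp add: algebra_simps)
    with v(1) show ?thesis by (intro exI[of _ v]) simp
  qed
  \<comment> \<open>Dependent choice, with \<open>True\<close> as the vacuous condition on single
    vertices.\<close>
  have "\<exists>v. \<forall>k. True \<and> (dep (v k) < dep (v (Suc k)) \<and>
      c - \<delta> \<le> cmod (\<psi> (v (Suc k))) * (harm (dep (v (Suc k))) - harm (dep (v k))))"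
    by (rule dependent_nat_choice) (use step in auto)
  then obtain v where v: "\<And>k. dep (v k) < dep (v (Suc k))"
    "\<And>k. c - \<delta> \<le> cmod (\<psi> (v (Suc k))) * (harm (dep (v (Suc k))) - harm (dep (v k)))"
    by blast
  \<comment> \<open>Half-open blocks: the level shared by consecutive blocks belongs to the earlier
    one, where its test function is evaluated.\<close>
  define A where "A = (\<lambda>k. {dep (v k)<..dep (v (Suc k))})"
  have mono: "dep (v j) \<le> dep (v k)" if "j \<le> k" for j k
    using lift_Suc_mono_le[of "\<lambda>k. dep (v k)", OF less_imp_le[OF v(1)] that] .
  have "A j \<inter> A k = {}" if "j < k" for j k
    using mono[of "Suc j" k] that by (auto simp: A_def)
  then have A: "disjoint_family A"
    unfolding disjoint_family_on_def by (metis Int_commute linorder_neqE_nat)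
  have fin: "finite (A k)" for k by (simp add: A_def)
  obtain k where k: "\<And>w. cmod (K (level_sum (A k)) w) < \<delta>"
    using compact_operator_level_sum_small[OF K X(2) fin A \<delta>] by blast
  let ?f = "level_sum (A k)" and ?w = "v (Suc k)"
  have "harm (dep (v k)) \<le> (harm (dep ?w) :: real)" by (rule harm_mono) (use v(1)[of k] in simp)
  then have "cmod (mult_operator \<psi> ?f ?w) = cmod (\<psi> ?w) * (harm (dep ?w) - harm (dep (v k)))"
    using level_sum_interval[of "dep (v k)" ?w] v(1)[of k]
    by (simp add: mult_operator_def norm_mult A_def del: of_real_diff)
  moreover have "cmod (mult_operator \<psi> ?f ?w - K ?f ?w) \<le> ?B"
    using X(2) level_sum_mem[OF fin] lipnorm_level_sum[OF fin]
    by (intro cmod_le_operator_norm[OF X(1) diff]) auto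
  moreover have "cmod (mult_operator \<psi> ?f ?w)
      \<le> cmod (mult_operator \<psi> ?f ?w - K ?f ?w) + cmod (K ?f ?w)"
    by (metis diff_add_cancel norm_triangle_ineq)
  ultimately have "c - \<delta> < ?B + \<delta>" using v(2)[of k] k[of ?w] by linarith
  then show False by (simp add: \<delta>_def field_simps)
qed

text \<open>Beyond level \<open>n\<close> the growth bound satisfies 1 + log |v| \<le> (1 + 1/log n)
  log |v|; \<open>2 \<le> n\<close> makes log n positive.\<close>

lemma operator_norm_truncation_le:
  assumes X: "X \<subseteq> weighted_lipschitz E r" "little_weighted_lipschitz E r \<subseteq> X"
    and n: "2 \<le> n" and c: "\<And>v. n \<le> dep v \<Longrightarrow> ln (real (dep v)) * cmod (\<psi> v) \<le> c"
  shows "operator_norm X lipnorm sup_norm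
    (\<lambda>f w. mult_operator \<psi> f w - mult_operator (\<lambda>v. if dep v < n then \<psi> v else 0) f w)
    \<le> (1 + 1 / ln (real n)) * c"
  unfolding operator_norm_def
proof (rule cSUP_least)
  have "level_sum {} \<in> X" "lipnorm (level_sum {}) \<le> 1"
    using X(2) level_sum_mem lipnorm_level_sum by blast+
  then show "{f \<in> X. lipnorm f \<le> 1} \<noteq> {}" by blast
  have ln: "0 < ln (real n)" using n by simp
  \<comment> \<open>Needed at vertices above level \<open>n\<close>, where the difference vanishes;
    a vertex of depth at least \<open>n\<close> supplies the sign.\<close>
  have c0: "0 \<le> c"
  proof -
    obtain v where v: "n \<le> dep v" using ex_depth_ge by blast
    then have "0 \<le> ln (real (dep v))" using n by simp
    then show ?thesis using c[OF v] order_trans[OF mult_nonneg_nonneg[OF _ norm_ge_zero]] by blast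
  qed
  fix f assume f: "f \<in> {f \<in> X. lipnorm f \<le> 1}"
  show "sup_norm (\<lambda>w. mult_operator \<psi> f w - mult_operator (\<lambda>v. if dep v < n then \<psi> v else 0) f w)
      \<le> (1 + 1 / ln (real n)) * c"
  proof (rule sup_norm_le)
    fix w
    show "cmod (mult_operator \<psi> f w - mult_operator (\<lambda>v. if dep v < n then \<psi> v else 0) f w)
        \<le> (1 + 1 / ln (real n)) * c"
    proof (cases "dep w < n")
      case True
      then show ?thesis using ln c0 by (simp add: mult_operator_def)
    next
      case False
      let ?l = "ln (real (dep w))"
      have "ln (real n) \<le> ?l" using False n by simp
      then have l: "1 + ?l \<le> (1 + 1 / ln (real n)) * ?l"
        using ln by (simp add: field_simps)
      have "cmod (f w) \<le> 1 + ?l" using f X(1) False n by (intro cmod_le_ln) auto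
      also note l
      finally have "cmod (\<psi> w) * cmod (f w) \<le> cmod (\<psi> w) * ((1 + 1 / ln (real n)) * ?l)"
        by (rule mult_left_mono) simp
      also have "\<dots> = (1 + 1 / ln (real n)) * (?l * cmod (\<psi> w))" by (simp add: mult_ac)
      also have "\<dots> \<le> (1 + 1 / ln (real n)) * c"
        using c[of w] False ln by (intro mult_left_mono) auto
      finally show ?thesis using False by (simp add: mult_operator_def norm_mult)
    qed
  qed
qed

end

theorem theorem4p7:
  fixes E :: "'a \<Rightarrow> 'a \<Rightarrow> bool" and r :: 'a
    and \<psi> :: "'a \<Rightarrow> complex" and X :: "('a \<Rightarrow> complex) set"
  assumes "is_tree E" and "\<And>v. \<not> terminal_vertex E v" and "infinite (UNIV :: 'a set)"
    and "X = weighted_lipschitz E r \<or> X = little_weighted_lipschitz E r"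
    and "bounded_operator X (weighted_lipschitz_norm E r) bounded_functions sup_norm
           (mult_operator \<psi>)"
  shows "(\<lambda>n. SUP v\<in>{v. n \<le> depth E r v}. ereal (ln (real (depth E r v)) * cmod (\<psi> v)))
           \<longlonglongrightarrow> ereal (essential_norm X (weighted_lipschitz_norm E r) bounded_functions sup_norm
                       (mult_operator \<psi>))"
proof -
  interpret rooted_tree E r using assms(1,3) by unfold_locales
  have X: "X \<subseteq> weighted_lipschitz E r" "little_weighted_lipschitz E r \<subseteq> X"
    using assms(4) by (auto simp: little_weighted_lipschitz_def)
  note M = assms(5)
  let ?g = "\<lambda>v. ln (real (dep v)) * cmod (\<psi> v)"
  let ?S = "\<lambda>n. SUP v\<in>{v. n \<le> dep v}. ereal (?g v)"
  let ?e = "essential_norm X lipnorm bounded_functions sup_norm (mult_operator \<psi>)"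
  let ?\<K> = "{K. compact_operator X lipnorm bounded_functions sup_norm K}"
  let ?N = "\<lambda>K. operator_norm X lipnorm sup_norm (\<lambda>f w. mult_operator \<psi> f w - K f w)"
  let ?T = "\<lambda>n. mult_operator (\<lambda>v. if dep v < n then \<psi> v else 0)"
  have T: "?T n \<in> ?\<K>" for n
    using compact_mult_operator_finite_support[OF X(1), of "\<lambda>v. if dep v < n then \<psi> v else 0"]
      finite_subset[OF _ finite_depth_less[of n]] by auto
  have "0 \<le> ?N K" if "K \<in> ?\<K>" for K
    using that by (intro operator_norm_nonneg[OF X] bounded_operator_diff M)
      (simp add: compact_operator_def)
  then have "bdd_below (?N ` ?\<K>)" by (auto simp: bdd_below_def)
  then have e_le: "?e \<le> ?N K" if "K \<in> ?\<K>" for K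
    unfolding essential_norm_def using that by (rule cINF_lower)
  have "ereal ?e \<le> (INF n. ?S n)"
  \<comment> \<open>A supremum may be infinite a priori, so it is compared through its real upper
    bounds \<open>c\<close>.\<close>
  proof (rule INF_greatest, rule ereal_le_real)
    fix n c assume "?S n \<le> ereal c"
    then have c: "?g v \<le> c" if "n \<le> dep v" for v
      using that by (simp add: SUP_le_iff)
    \<comment> \<open>The bound \<open>c\<close> from level \<open>n\<close> serves every deeper
      truncation level \<open>m\<close>; letting \<open>m\<close> tend to infinity removes the
      factor.\<close>
    have "?e \<le> (1 + 1 / ln (real m)) * c" if "max 2 n \<le> m" for m
    proof -
      have "?N (?T m) \<le> (1 + 1 / ln (real m)) * c"
        using that c by (intro operator_norm_truncation_le[OF X]) auto
      with e_le[OF T[of m]] show ?thesis by linarith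
    qed
    moreover have "(\<lambda>m. (1 + 1 / ln (real m)) * c) \<longlonglongrightarrow> (1 + 0) * c"
      by (intro tendsto_intros tendsto_divide_0[OF tendsto_const] filterlim_at_top_imp_at_infinity
          filterlim_compose[OF ln_at_top filterlim_real_sequentially])
    ultimately have "?e \<le> (1 + 0) * c"
      by (intro LIMSEQ_le_const) blast+
    then show "ereal ?e \<le> ereal c" by simp
  qed
  moreover have "(INF n. ?S n) \<le> ereal ?e"
  proof (rule ccontr)
    assume "\<not> ?thesis"
    then have "ereal ?e < (INF n. ?S n)" by (simp only: not_le)
    \<comment> \<open>Every supremum exceeds this real \<open>c\<close>, which yields arbitrarily
      deep vertices with \<open>c < ?g v\<close>.\<close>
    then obtain c where c: "?e < c" "ereal c < (INF n. ?S n)"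
      using ereal_dense2[of "ereal ?e"] less_ereal.simps(1) by blast
    have "\<exists>v. n \<le> dep v \<and> c < ?g v" for n
    proof -
      have "ereal c < ?S n" using c(2) by (rule less_le_trans) (auto intro: INF_lower)
      then show ?thesis by (auto simp: less_SUP_iff)
    qed
    then have "c \<le> ?N K" if "K \<in> ?\<K>" for K
      using that by (intro operator_norm_compact_perturbation_ge[OF X M]) auto
    \<comment> \<open>\<open>?T 0\<close> witnesses that the infimum is over a nonempty set.\<close>
    then have "c \<le> ?e"
      unfolding essential_norm_def using T[of 0] by (intro cINF_greatest) auto
    then show False using c(1) by simp
  qed
  \<comment> \<open>The suprema run over shrinking sets, so their limit is their infimum.\<close>
  moreover have "decseq ?S"
    unfolding decseq_def by (auto intro!: SUP_subset_mono)
  then have "?S \<longlonglongrightarrow> (INF n. ?S n)" by (rule LIMSEQ_INF)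
  ultimately show ?thesis by simp
qed

end
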